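(* Let $\kappa$ be a cardinal that is first-order sententially categorical, or second-order sententially categorical, or $\alpha$-order sententially categorical for some absolutely definable ordinal $\alpha$. Then the next inaccessible cardinal above $\kappa$, if it exists, is first-order sententially categorical.
   Context: $V_\kappa$ denotes the rank-initial segment of the cumulative hierarchy. An ordinal $\alpha$ is absolutely definable if there is a first-order formula $\psi(x)$ such that for every inaccessible $\kappa$, $\alpha\in V_\kappa$ and $\alpha$ is the unique element of $V_\kappa$ satisfying $\psi$ in $V_\kappa$. An $\alpha$-order sentence about $V_\kappa$ is understood as a first-order assertion about $V_{\kappa+\alpha}$ (with $V_\kappa$ available as the base domain); first-order means order $0$ (evaluated in $V_\kappa$) and second-order means second-order quantifiers range over all subsets of $V_\kappa$. A cardinal $\kappa$ is sententially categorical of a given order if there is a sentence $\sigma$ of that order such that $\kappa$ is inaccessible, $V_\kappa\models\sigma$, and $V_\lambda\not\models\sigma$ for every inaccessible $\lambda\neq\kappa$. *)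

theory Defs
  imports "HOL-Library.Equipollence" "HOL-Library.Countable_Set"
begin

text \<open>
  The ambient set-theoretic universe is a type whose elements are the sets; HOL predicates and
  functions on it play the role of classes. The axiom of choice is not listed because it follows
  from Hilbert choice together with separation.
\<close>

class zfc_universe =
  fixes elts :: "'a \<Rightarrow> 'a set"
  assumes extensionality: "elts x = elts y \<Longrightarrow> x = y"
    and foundation: "wf {(x, y). x \<in> elts y}"
    and pairing: "\<exists>z. elts z = {x, y}"
    and union: "\<exists>y. elts y = (\<Union>z\<in>elts x. elts z)"
    and power_set: "\<exists>y. elts y = {z. elts z \<subseteq> elts x}"
    and infinity: "\<exists>w. (\<exists>e\<in>elts w. elts e = {}) \<and>
                       (\<forall>x\<in>elts w. \<exists>y\<in>elts w. elts y = insert x (elts x))"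
    and separation: "\<exists>y. elts y = {z \<in> elts x. P z}"
    and replacement: "\<exists>y. elts y = f ` elts x"


definition transitive :: "'v::zfc_universe \<Rightarrow> bool" where
  "transitive x \<longleftrightarrow> (\<forall>y\<in>elts x. elts y \<subseteq> elts x)"

definition ordinal :: "'v::zfc_universe \<Rightarrow> bool" where
  "ordinal x \<longleftrightarrow> transitive x \<and> (\<forall>y\<in>elts x. transitive y)"

definition cardinal :: "'v::zfc_universe \<Rightarrow> bool" where
  "cardinal \<kappa> \<longleftrightarrow> ordinal \<kappa> \<and> (\<forall>\<beta>\<in>elts \<kappa>. elts \<beta> \<prec> elts \<kappa>)"

definition regular :: "'v::zfc_universe \<Rightarrow> bool" where
  "regular \<kappa> \<longleftrightarrow>
     (\<forall>X. X \<subseteq> elts \<kappa> \<and> X \<prec> elts \<kappa> \<longrightarrow> (\<exists>\<beta>\<in>elts \<kappa>. X \<subseteq> elts \<beta>))"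

definition strong_limit :: "'v::zfc_universe \<Rightarrow> bool" where
  "strong_limit \<kappa> \<longleftrightarrow> (\<forall>\<beta>\<in>elts \<kappa>. Pow (elts \<beta>) \<prec> elts \<kappa>)"

definition inaccessible :: "'v::zfc_universe \<Rightarrow> bool" where
  "inaccessible \<kappa> \<longleftrightarrow>
     cardinal \<kappa> \<and> uncountable (elts \<kappa>) \<and> regular \<kappa> \<and> strong_limit \<kappa>"

definition next_inaccessible :: "'v::zfc_universe \<Rightarrow> 'v \<Rightarrow> bool" where
  "next_inaccessible \<kappa> \<mu> \<longleftrightarrow> inaccessible \<mu> \<and> \<kappa> \<in> elts \<mu> \<and>
     (\<forall>\<nu>. inaccessible \<nu> \<and> \<kappa> \<in> elts \<nu> \<longrightarrow> \<mu> = \<nu> \<or> \<mu> \<in> elts \<nu>)"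

text \<open>
  \<open>Vset a\<close> is the rank-initial segment \<open>V\<^sub>a\<close>, represented by the collection of its elements
  rather than by an element of the universe.
\<close>

function Vset :: "'v::zfc_universe \<Rightarrow> 'v set" where
  "Vset a = (\<Union>b\<in>elts a. {x. elts x \<subseteq> Vset b})"
  by auto
termination
  by (relation "{(x, y). x \<in> elts y}") (auto simp: foundation)

declare Vset.simps [simp del]

text \<open>Unspecified if \<open>X\<close> is a proper class.\<close>

definition set_of :: "'v::zfc_universe set \<Rightarrow> 'v" where
  "set_of X = (THE x. elts x = X)"

function oadd :: "'v::zfc_universe \<Rightarrow> 'v \<Rightarrow> 'v" where
  "oadd a b = set_of (elts a \<union> (\<lambda>c. oadd a c) ` elts b)"
  by auto
termination
  by (relation "inv_image {(x, y). x \<in> elts y} snd") (auto simp: foundation)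

declare oadd.simps [simp del]


datatype fm =
    Mem nat nat
  | Equal nat nat
  | Neg fm
  | Conj fm fm
  | All nat fm

primrec fv :: "fm \<Rightarrow> nat set" where
  "fv (Mem i j) = {i, j}"
| "fv (Equal i j) = {i, j}"
| "fv (Neg \<phi>) = fv \<phi>"
| "fv (Conj \<phi> \<psi>) = fv \<phi> \<union> fv \<psi>"
| "fv (All i \<phi>) = fv \<phi> - {i}"

primrec sat :: "'v::zfc_universe set \<Rightarrow> (nat \<Rightarrow> 'v) \<Rightarrow> fm \<Rightarrow> bool" where
  "sat M e (Mem i j) \<longleftrightarrow> e i \<in> elts (e j)"
| "sat M e (Equal i j) \<longleftrightarrow> e i = e j"
| "sat M e (Neg \<phi>) \<longleftrightarrow> \<not> sat M e \<phi>"
| "sat M e (Conj \<phi> \<psi>) \<longleftrightarrow> sat M e \<phi> \<and> sat M e \<psi>"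
| "sat M e (All i \<phi>) \<longleftrightarrow> (\<forall>a\<in>M. sat M (e(i := a)) \<phi>)"

definition models :: "'v::zfc_universe set \<Rightarrow> fm \<Rightarrow> bool" where
  "models M \<sigma> \<longleftrightarrow> (\<forall>e. range e \<subseteq> M \<longrightarrow> sat M e \<sigma>)"

definition absolutely_definable :: "'v::zfc_universe \<Rightarrow> bool" where
  "absolutely_definable \<alpha> \<longleftrightarrow> ordinal \<alpha> \<and>
     (\<exists>\<psi>. fv \<psi> \<subseteq> {0} \<and>
       (\<forall>\<kappa>. inaccessible \<kappa> \<longrightarrow>
         \<alpha> \<in> Vset \<kappa> \<and> (\<forall>x\<in>Vset \<kappa>. sat (Vset \<kappa>) (\<lambda>_. x) \<psi> \<longleftrightarrow> x = \<alpha>)))"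


datatype so_fm =
    SMem nat nat
  | SEqual nat nat
  | InSet nat nat
  | SNeg so_fm
  | SConj so_fm so_fm
  | SAll nat so_fm
  | SAllSet nat so_fm

primrec so_fv :: "so_fm \<Rightarrow> nat set" where
  "so_fv (SMem i j) = {i, j}"
| "so_fv (SEqual i j) = {i, j}"
| "so_fv (InSet i j) = {i}"
| "so_fv (SNeg \<phi>) = so_fv \<phi>"
| "so_fv (SConj \<phi> \<psi>) = so_fv \<phi> \<union> so_fv \<psi>"
| "so_fv (SAll i \<phi>) = so_fv \<phi> - {i}"
| "so_fv (SAllSet j \<phi>) = so_fv \<phi>"

primrec so_set_fv :: "so_fm \<Rightarrow> nat set" where
  "so_set_fv (SMem i j) = {}"
| "so_set_fv (SEqual i j) = {}"
| "so_set_fv (InSet i j) = {j}"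
| "so_set_fv (SNeg \<phi>) = so_set_fv \<phi>"
| "so_set_fv (SConj \<phi> \<psi>) = so_set_fv \<phi> \<union> so_set_fv \<psi>"
| "so_set_fv (SAll i \<phi>) = so_set_fv \<phi>"
| "so_set_fv (SAllSet j \<phi>) = so_set_fv \<phi> - {j}"

primrec so_sat ::
    "'v::zfc_universe set \<Rightarrow> (nat \<Rightarrow> 'v) \<Rightarrow> (nat \<Rightarrow> 'v set) \<Rightarrow> so_fm \<Rightarrow> bool" where
  "so_sat M e s (SMem i j) \<longleftrightarrow> e i \<in> elts (e j)"
| "so_sat M e s (SEqual i j) \<longleftrightarrow> e i = e j"
| "so_sat M e s (InSet i j) \<longleftrightarrow> e i \<in> s j"
| "so_sat M e s (SNeg \<phi>) \<longleftrightarrow> \<not> so_sat M e s \<phi>"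
| "so_sat M e s (SConj \<phi> \<psi>) \<longleftrightarrow> so_sat M e s \<phi> \<and> so_sat M e s \<psi>"
| "so_sat M e s (SAll i \<phi>) \<longleftrightarrow> (\<forall>a\<in>M. so_sat M (e(i := a)) s \<phi>)"
| "so_sat M e s (SAllSet j \<phi>) \<longleftrightarrow> (\<forall>A. A \<subseteq> M \<longrightarrow> so_sat M e (s(j := A)) \<phi>)"

definition so_models :: "'v::zfc_universe set \<Rightarrow> so_fm \<Rightarrow> bool" where
  "so_models M \<sigma> \<longleftrightarrow>
     (\<forall>e s. range e \<subseteq> M \<and> (\<forall>j. s j \<subseteq> M) \<longrightarrow> so_sat M e s \<sigma>)"


text \<open>
  Formulas for a structure \<open>M\<close> with a distinguished base \<open>B \<subseteq> M\<close>, available as the unary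
  predicate \<open>Base\<close>. With \<open>M = V\<^bsub>\<kappa>+\<alpha>\<^esub>\<close> and \<open>B = V\<^sub>\<kappa>\<close> these are the \<open>\<alpha>\<close>-order
  assertions about \<open>V\<^sub>\<kappa>\<close>. A predicate rather than a constant is used since \<open>V\<^sub>\<kappa>\<close> is not
  an element of \<open>V\<^bsub>\<kappa>+\<alpha>\<^esub>\<close> when \<open>\<alpha> = 0\<close>.
\<close>

datatype ho_fm =
    HMem nat nat
  | HEqual nat nat
  | Base nat
  | HNeg ho_fm
  | HConj ho_fm ho_fm
  | HAll nat ho_fm

primrec ho_fv :: "ho_fm \<Rightarrow> nat set" where
  "ho_fv (HMem i j) = {i, j}"
| "ho_fv (HEqual i j) = {i, j}"
| "ho_fv (Base i) = {i}"
| "ho_fv (HNeg \<phi>) = ho_fv \<phi>"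
| "ho_fv (HConj \<phi> \<psi>) = ho_fv \<phi> \<union> ho_fv \<psi>"
| "ho_fv (HAll i \<phi>) = ho_fv \<phi> - {i}"

primrec ho_sat ::
    "'v::zfc_universe set \<Rightarrow> 'v set \<Rightarrow> (nat \<Rightarrow> 'v) \<Rightarrow> ho_fm \<Rightarrow> bool" where
  "ho_sat M B e (HMem i j) \<longleftrightarrow> e i \<in> elts (e j)"
| "ho_sat M B e (HEqual i j) \<longleftrightarrow> e i = e j"
| "ho_sat M B e (Base i) \<longleftrightarrow> e i \<in> B"
| "ho_sat M B e (HNeg \<phi>) \<longleftrightarrow> \<not> ho_sat M B e \<phi>"
| "ho_sat M B e (HConj \<phi> \<psi>) \<longleftrightarrow> ho_sat M B e \<phi> \<and> ho_sat M B e \<psi>"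
| "ho_sat M B e (HAll i \<phi>) \<longleftrightarrow> (\<forall>a\<in>M. ho_sat M B (e(i := a)) \<phi>)"

definition ho_models :: "'v::zfc_universe set \<Rightarrow> 'v set \<Rightarrow> ho_fm \<Rightarrow> bool" where
  "ho_models M B \<sigma> \<longleftrightarrow> (\<forall>e. range e \<subseteq> M \<longrightarrow> ho_sat M B e \<sigma>)"


definition first_order_sententially_categorical :: "'v::zfc_universe \<Rightarrow> bool" where
  "first_order_sententially_categorical \<kappa> \<longleftrightarrow>
     (\<exists>\<sigma>. fv \<sigma> = {} \<and> inaccessible \<kappa> \<and> models (Vset \<kappa>) \<sigma> \<and>
       (\<forall>\<mu>. inaccessible \<mu> \<and> \<mu> \<noteq> \<kappa> \<longrightarrow> \<not> models (Vset \<mu>) \<sigma>))"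

definition second_order_sententially_categorical :: "'v::zfc_universe \<Rightarrow> bool" where
  "second_order_sententially_categorical \<kappa> \<longleftrightarrow>
     (\<exists>\<sigma>. so_fv \<sigma> = {} \<and> so_set_fv \<sigma> = {} \<and> inaccessible \<kappa> \<and> so_models (Vset \<kappa>) \<sigma> \<and>
       (\<forall>\<mu>. inaccessible \<mu> \<and> \<mu> \<noteq> \<kappa> \<longrightarrow> \<not> so_models (Vset \<mu>) \<sigma>))"

definition order_sententially_categorical :: "'v::zfc_universe \<Rightarrow> 'v \<Rightarrow> bool" where
  "order_sententially_categorical \<alpha> \<kappa> \<longleftrightarrow>
     (\<exists>\<sigma>. ho_fv \<sigma> = {} \<and> inaccessible \<kappa> \<and>
       ho_models (Vset (oadd \<kappa> \<alpha>)) (Vset \<kappa>) \<sigma> \<and>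
       (\<forall>\<mu>. inaccessible \<mu> \<and> \<mu> \<noteq> \<kappa> \<longrightarrow>
         \<not> ho_models (Vset (oadd \<mu> \<alpha>)) (Vset \<mu>) \<sigma>))"

end

theory Submission
  imports Defs
begin

text \<open>
  If \<open>\<sigma>\<close> characterizes \<open>\<kappa>\<close>, then the next inaccessible is characterized by the first-order sentence
  ``there is an inaccessible \<open>\<delta>\<close> whose \<open>V\<^sub>\<delta>\<close> satisfies \<open>\<sigma>\<close>, and no inaccessible lies above \<open>\<delta>\<close>''.
  For inaccessible \<open>\<nu>\<close>, the level \<open>V\<^sub>\<nu>\<close> is closed under power sets and contains \<open>V\<^bsub>\<delta>+\<alpha>\<^esub>\<close> for
  all \<open>\<delta>, \<alpha> < \<nu>\<close>. Hence \<open>V\<^sub>\<nu>\<close> computes inaccessibility and these levels correctly, and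
  satisfaction of \<open>\<sigma>\<close> in them, of whichever order, becomes a bounded first-order statement.
\<close>

section \<open>Sets and ordinals\<close>

lemma elts_set_of: "\<exists>x. elts x = X \<Longrightarrow> elts (set_of X :: 'v::zfc_universe) = X"
  unfolding set_of_def by (metis (mono_tags, lifting) extensionality theI)

lemma elts_inject: "elts x = elts y \<longleftrightarrow> x = (y :: 'v::zfc_universe)"
  using extensionality by blast

lemma elts_induct [case_names step]:
  assumes "\<And>x :: 'v::zfc_universe. (\<And>y. y \<in> elts x \<Longrightarrow> P y) \<Longrightarrow> P x"
  shows "P x"
  using wf_induct_rule[OF foundation, of P x] assms by blast

lemma mem_irrefl: "x \<notin> elts (x :: 'v::zfc_universe)"
  using wf_not_refl[OF foundation] by blast

lemma mem_asym: "x \<in> elts y \<Longrightarrow> y \<notin> elts (x :: 'v::zfc_universe)"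
  using wf_not_sym[OF foundation] by blast

text \<open>Separation accepts every HOL predicate, so each subcollection of a set is again a set.
  This is what lets quantifiers over HOL subsets be traded for quantifiers over elements.\<close>

lemma small_subset: "X \<subseteq> elts (a :: 'v::zfc_universe) \<Longrightarrow> \<exists>x. elts x = X"
  using separation[of a "\<lambda>z. z \<in> X"] by (metis Collect_mem_eq Int_absorb1 Int_def)

lemma small_UN: "\<exists>y. elts y = (\<Union>c\<in>elts (a :: 'v::zfc_universe). elts (f c :: 'v))"
proof -
  obtain r where r: "elts r = f ` elts a"
    using replacement by blast
  show ?thesis
    using union[of r] by (simp add: r)
qed

lemma small_Un: "\<exists>z. elts z = elts x \<union> elts (y :: 'v::zfc_universe)"
proof -
  obtain p where p: "elts p = {x, y}"
    using pairing by blast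
  show ?thesis
    using union[of p] by (simp add: p)
qed

section \<open>Pairs, power sets and binary unions as elements of the universe\<close>

definition upair :: "'v::zfc_universe \<Rightarrow> 'v \<Rightarrow> 'v" where
  "upair x y = set_of {x, y}"

text \<open>The Kuratowski pair.\<close>

definition opair :: "'v::zfc_universe \<Rightarrow> 'v \<Rightarrow> 'v" where
  "opair x y = upair (upair x x) (upair x y)"

definition vpow :: "'v::zfc_universe \<Rightarrow> 'v" where
  "vpow x = set_of {z. elts z \<subseteq> elts x}"

definition vun :: "'v::zfc_universe \<Rightarrow> 'v \<Rightarrow> 'v" where
  "vun x y = set_of (elts x \<union> elts y)"

lemma elts_upair [simp]: "elts (upair x y) = {x, y :: 'v::zfc_universe}"
  unfolding upair_def by (rule elts_set_of) (rule pairing)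

lemma elts_vpow [simp]: "elts (vpow x) = {z. elts z \<subseteq> elts (x :: 'v::zfc_universe)}"
  unfolding vpow_def by (rule elts_set_of) (rule power_set)

lemma elts_vun [simp]: "elts (vun x y) = elts x \<union> elts (y :: 'v::zfc_universe)"
  unfolding vun_def by (rule elts_set_of) (rule small_Un)

lemma opair_inject [simp]:
  "opair x y = opair x' y' \<longleftrightarrow> x = x' \<and> y = (y' :: 'v::zfc_universe)"
  unfolding opair_def
  by (metis elts_upair doubleton_eq_iff elts_inject)

section \<open>Ordinals and ordinal addition\<close>

lemma ordinal_mem: "ordinal a \<Longrightarrow> b \<in> elts a \<Longrightarrow> ordinal b"
  unfolding ordinal_def transitive_def by blast

lemma ordinal_transD: "ordinal a \<Longrightarrow> b \<in> elts a \<Longrightarrow> c \<in> elts b \<Longrightarrow> c \<in> elts a"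
  unfolding ordinal_def transitive_def by blast

text \<open>Membership induction on \<open>a\<close>, and inside it on \<open>b\<close>. If the two
  were incomparable, the induction hypotheses would put every member of each into the other, so they
  would be equal.\<close>

lemma ordinal_linear:
  "ordinal a \<Longrightarrow> ordinal b \<Longrightarrow> a \<in> elts b \<or> a = b \<or> b \<in> elts (a :: 'v::zfc_universe)"
proof (induction a arbitrary: b rule: elts_induct)
  case (step a)
  note IHa = step.IH and a = step.prems(1)
  from step.prems(2) show ?case
  proof (induction b rule: elts_induct)
    case (step b)
    show ?case
    proof (rule ccontr)
      assume n: "\<not> ?thesis"
      have "elts a \<subseteq> elts b"
      proof
        fix x assume x: "x \<in> elts a"
        from IHa[OF x ordinal_mem[OF a x] step.prems] n x a
        show "x \<in> elts b" by (metis ordinal_transD)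
      qed
      moreover have "elts b \<subseteq> elts a"
      proof
        fix x assume x: "x \<in> elts b"
        from step.IH[OF x ordinal_mem[OF step.prems x]] n x step.prems
        show "x \<in> elts a" by (metis ordinal_transD)
      qed
      ultimately show False
        using n extensionality by blast
    qed
  qed
qed

lemma elts_oadd: "elts (oadd a b) = elts a \<union> oadd a ` elts (b :: 'v::zfc_universe)"
proof -
  obtain r where r: "elts r = oadd a ` elts b"
    using replacement by blast
  show ?thesis
    by (subst oadd.simps, rule elts_set_of) (metis r small_Un)
qed


section \<open>The cumulative hierarchy\<close>

lemma mem_Vset: "x \<in> Vset a \<longleftrightarrow> (\<exists>b\<in>elts a. elts x \<subseteq> Vset b)"
  by (subst Vset.simps) blast

lemma Vset_mono: "ordinal a \<Longrightarrow> b \<in> elts a \<Longrightarrow> Vset b \<subseteq> Vset a"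
  using mem_Vset ordinal_transD by blast

lemma Vset_trans: "ordinal a \<Longrightarrow> x \<in> Vset a \<Longrightarrow> elts x \<subseteq> Vset a"
  using mem_Vset Vset_mono by blast

lemma Vset_subset: "x \<in> Vset a \<Longrightarrow> elts z \<subseteq> elts x \<Longrightarrow> z \<in> Vset a"
  using mem_Vset by (metis subset_trans)

text \<open>\<open>Vset a\<close> contains every subset of each of its elements, so second-order
  quantification over subsets of \<open>x\<close> is first-order quantification over
  \<open>Vset a\<close>.\<close>

lemma all_subset_iff_Vset:
  assumes "x \<in> Vset a"
  shows "(\<forall>X. X \<subseteq> elts x \<longrightarrow> P X) \<longleftrightarrow> (\<forall>z\<in>Vset a. elts z \<subseteq> elts x \<longrightarrow> P (elts z))"
proof (intro iffI allI impI)
  fix X assume *: "\<forall>z\<in>Vset a. elts z \<subseteq> elts x \<longrightarrow> P (elts z)" and X: "X \<subseteq> elts x"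
  then obtain z where "elts z = X"
    using small_subset by blast
  then show "P X"
    using * X Vset_subset[OF assms] by blast
qed blast

lemma ordinal_subset_Vset: "ordinal a \<Longrightarrow> elts a \<subseteq> Vset (a :: 'v::zfc_universe)"
proof (induction a rule: elts_induct)
  case (step a)
  then show ?case
    using mem_Vset ordinal_mem by blast
qed

text \<open>If \<open>elts x \<subseteq> Vset b\<close> with \<open>b\<close> in \<open>a\<close>,
  induction gives \<open>elts x \<subseteq> elts b\<close>. So \<open>b\<close> is not in
  \<open>x\<close>, and linearity leaves \<open>x \<in> elts b\<close> or
  \<open>x = b\<close>.\<close>

lemma ordinal_in_Vset_imp_mem:
  "ordinal a \<Longrightarrow> ordinal x \<Longrightarrow> x \<in> Vset a \<Longrightarrow> x \<in> elts (a :: 'v::zfc_universe)"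
proof (induction a arbitrary: x rule: elts_induct)
  case (step a)
  then obtain b where b: "b \<in> elts a" "elts x \<subseteq> Vset b"
    using mem_Vset by blast
  then have "elts x \<subseteq> elts b"
    using step ordinal_mem by (metis subset_iff)
  then have "b \<notin> elts x"
    using mem_irrefl by blast
  then show ?case
    using ordinal_linear[of x b] b step.prems ordinal_mem ordinal_transD by blast
qed

text \<open>
  Base \<open>V\<^sub>\<kappa>\<close> gives \<open>V\<^bsub>\<kappa>+g\<^esub>\<close> and the
  empty base gives \<open>V\<^sub>g\<close>, so one recursion covers both.
\<close>

function hier :: "'v::zfc_universe \<Rightarrow> 'v \<Rightarrow> 'v" where
  "hier b g = set_of (elts b \<union> (\<Union>c\<in>elts g. elts (vpow (hier b c))))"
  by auto
termination
  by (relation "inv_image {(x, y). x \<in> elts y} snd") (auto simp: foundation)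

declare hier.simps [simp del]

lemma elts_hier:
  "elts (hier b g) = elts b \<union> (\<Union>c\<in>elts g. {x. elts x \<subseteq> elts (hier b c)})"
  for b :: "'v::zfc_universe"
proof -
  have "\<exists>z. elts z = elts b \<union> (\<Union>c\<in>elts g. elts (vpow (hier b c)))"
    using small_UN[where a = g and f = "\<lambda>c. vpow (hier b c)"] small_Un by metis
  from elts_set_of[OF this] show ?thesis
    by (subst hier.simps) simp
qed

lemma hier_mono: "ordinal g \<Longrightarrow> c \<in> elts g \<Longrightarrow> elts (hier b c) \<subseteq> elts (hier b g)"
  by (subst (1 2) elts_hier) (use ordinal_transD in blast)

lemma elts_hier_empty: "elts b = {} \<Longrightarrow> elts (hier b a) = Vset (a :: 'v::zfc_universe)"
proof (induction a rule: elts_induct)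
  case (step a)
  then show ?case
    by (subst elts_hier, subst Vset.simps) simp
qed

text \<open>By \<open>elts_oadd\<close>, the union defining \<open>Vset (oadd k a)\<close> splits
  into the indices in \<open>k\<close>, which yield the base, and the indices
  \<open>oadd k c\<close>, which yield the power sets of earlier stages.\<close>

lemma elts_hier_Vset:
  "elts b = Vset k \<Longrightarrow> elts (hier b a) = Vset (oadd k (a :: 'v::zfc_universe))"
proof (induction a rule: elts_induct)
  case (step a)
  then show ?case
    by (subst elts_hier, subst Vset.simps) (simp add: elts_oadd Vset.simps[of k])
qed

text \<open>The level \<open>Vset a\<close> as an element of the universe, so that first-order
  quantifiers can range over levels.\<close>

definition Vof :: "'v::zfc_universe \<Rightarrow> 'v" where
  "Vof a = hier (set_of {}) a"

lemma elts_empty [simp]: "elts (set_of {} :: 'v::zfc_universe) = {}"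
  by (rule elts_set_of) (use small_subset in blast)

lemma elts_Vof [simp]: "elts (Vof a) = Vset a"
  unfolding Vof_def by (rule elts_hier_empty) simp


section \<open>Closure properties at inaccessible levels\<close>

context
  fixes \<nu> :: "'v::zfc_universe"
  assumes inacc: "inaccessible \<nu>"
begin

section \<open>Boundedness below \<open>\<nu>\<close> and closure of its level\<close>

lemma inaccessible_ordinal: "ordinal \<nu>"
  using inacc by (simp add: inaccessible_def cardinal_def)

lemma inaccessible_bound:
  assumes "X \<subseteq> elts \<nu>" "X \<prec> elts \<nu>"
  obtains \<beta> where "\<beta> \<in> elts \<nu>" "X \<subseteq> elts \<beta>"
  using inacc assms by (auto simp: inaccessible_def regular_def)

text \<open>Regularity applied to a two-element subset of the infinite \<open>\<nu>\<close>; this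
  serves as the limit property of \<open>\<nu>\<close>.\<close>

lemma inaccessible_bound2:
  assumes "b \<in> elts \<nu>" "c \<in> elts \<nu>"
  obtains \<beta> where "\<beta> \<in> elts \<nu>" "b \<in> elts \<beta>" "c \<in> elts \<beta>"
proof -
  have "infinite (elts \<nu>)"
    using inacc uncountable_infinite by (auto simp: inaccessible_def)
  then have "{b, c} \<prec> elts \<nu>"
    by (intro finite_lesspoll_infinite) auto
  with assms show ?thesis
    using inaccessible_bound[of "{b, c}"] that by auto
qed

lemma Vset_mem_trans: "x \<in> Vset \<nu> \<Longrightarrow> y \<in> elts x \<Longrightarrow> y \<in> Vset \<nu>"
  using Vset_trans inaccessible_ordinal by blast

text \<open>A single level below \<open>\<nu>\<close> that has \<open>x\<close> and \<open>y\<close>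
  both as members and as subsets. Any set assembled from their elements, or from \<open>x\<close>
  and \<open>y\<close> themselves, then appears one level later, still below
  \<open>\<nu>\<close>.\<close>

lemma Vset_cover2:
  assumes "x \<in> Vset \<nu>" "y \<in> Vset \<nu>"
  obtains \<beta> where "\<beta> \<in> elts \<nu>" "elts x \<subseteq> Vset \<beta>" "elts y \<subseteq> Vset \<beta>" "x \<in> Vset \<beta>" "y \<in> Vset \<beta>"
proof -
  obtain b c where bc: "b \<in> elts \<nu>" "elts x \<subseteq> Vset b" "c \<in> elts \<nu>" "elts y \<subseteq> Vset c"
    using assms mem_Vset by blast
  obtain \<beta> where \<beta>: "\<beta> \<in> elts \<nu>" "b \<in> elts \<beta>" "c \<in> elts \<beta>"
    using inaccessible_bound2 bc by blast
  then have xy: "x \<in> Vset \<beta>" "y \<in> Vset \<beta>"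
    using bc mem_Vset by blast+
  have "ordinal \<beta>"
    using \<beta> inaccessible_ordinal ordinal_mem by blast
  then show ?thesis
    using that[OF \<beta>(1)] xy Vset_trans by blast
qed

lemma upair_in_Vset: "x \<in> Vset \<nu> \<Longrightarrow> y \<in> Vset \<nu> \<Longrightarrow> upair x y \<in> Vset \<nu>"
  by (erule (1) Vset_cover2) (auto simp: mem_Vset[of "upair x y"])

lemma vun_in_Vset: "x \<in> Vset \<nu> \<Longrightarrow> y \<in> Vset \<nu> \<Longrightarrow> vun x y \<in> Vset \<nu>"
  by (erule (1) Vset_cover2) (auto simp: mem_Vset[of "vun x y"])

lemma vpow_in_Vset:
  assumes "x \<in> Vset \<nu>"
  shows "vpow x \<in> Vset \<nu>"
proof -
  obtain \<beta> where "\<beta> \<in> elts \<nu>" "x \<in> Vset \<beta>"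
    using Vset_cover2 assms by metis
  moreover have "elts (vpow x) \<subseteq> Vset \<beta>"
    using \<open>x \<in> Vset \<beta>\<close> Vset_subset by auto
  ultimately show ?thesis
    using mem_Vset by blast
qed

text \<open>A Kuratowski pair over \<open>a\<close> is a set of subsets of \<open>a\<close>, so the
  relation is a subset of the double power set of \<open>a\<close>.\<close>

lemma relation_in_Vset:
  assumes "a \<in> Vset \<nu>" "\<And>p. p \<in> elts f \<Longrightarrow> \<exists>u\<in>elts a. \<exists>v\<in>elts a. p = opair u v"
  shows "f \<in> Vset \<nu>"
proof -
  have "elts f \<subseteq> elts (vpow (vpow a))"
    using assms(2) by (fastforce simp: opair_def)
  then show ?thesis
    using assms(1) vpow_in_Vset Vset_subset by blast
qed

text \<open>Every stage before \<open>g\<close> is contained in some level below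
  \<open>\<nu>\<close>. There are fewer than \<open>\<nu>\<close> stages, so regularity bounds all
  these levels at once.\<close>

lemma hier_in_Vset:
  assumes "b \<in> Vset \<nu>"
  shows "g \<in> elts \<nu> \<Longrightarrow> hier b g \<in> Vset \<nu>"
proof (induction g rule: elts_induct)
  case (step g)
  have "\<exists>r\<in>elts \<nu>. elts (hier b c) \<subseteq> Vset r" if "c \<in> elts g" for c
    using step that inaccessible_ordinal ordinal_transD mem_Vset by blast
  then obtain r where r: "\<And>c. c \<in> elts g \<Longrightarrow> r c \<in> elts \<nu> \<and> elts (hier b c) \<subseteq> Vset (r c)"
    by metis
  have "elts g \<prec> elts \<nu>"
    using inacc step.prems by (simp add: inaccessible_def cardinal_def)
  then have "r ` elts g \<prec> elts \<nu>"
    using image_lepoll lesspoll_trans1 by blast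
  then obtain \<beta> where \<beta>: "\<beta> \<in> elts \<nu>" "r ` elts g \<subseteq> elts \<beta>"
    using r inaccessible_bound[of "r ` elts g"] by blast
  obtain d where d: "d \<in> elts \<nu>" "elts b \<subseteq> Vset d"
    using assms mem_Vset by blast
  \<comment> \<open>\<open>\<beta>\<close> bounds the levels of the earlier stages and
    \<open>d\<close> covers the base. Their subsets sit one level higher, hence a strict bound of
    both.\<close>
  obtain \<gamma> where \<gamma>: "\<gamma> \<in> elts \<nu>" "\<beta> \<in> elts \<gamma>" "d \<in> elts \<gamma>"
    using inaccessible_bound2 \<beta> d by blast
  have ord: "ordinal \<gamma>" "ordinal \<beta>"
    using \<gamma> \<beta> inaccessible_ordinal ordinal_mem by blast+
  have "elts (hier b g) \<subseteq> Vset \<gamma>"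
  proof
    fix x assume "x \<in> elts (hier b g)"
    then consider "x \<in> elts b" | c where "c \<in> elts g" "elts x \<subseteq> elts (hier b c)"
      by (auto simp: elts_hier[of b g])
    then show "x \<in> Vset \<gamma>"
    proof cases
      case 1
      then show ?thesis
        using d \<gamma> Vset_mono ord by blast
    next
      case 2
      then have "elts x \<subseteq> Vset \<beta>"
        using r \<beta> Vset_mono[OF ord(2)] by blast
      then show ?thesis
        using \<gamma> mem_Vset by blast
    qed
  qed
  then show ?case
    using \<gamma> mem_Vset by blast
qed

lemma empty_in_Vset: "set_of {} \<in> Vset \<nu>"
proof -
  have "elts \<nu> \<noteq> {}"
    using inacc by (auto simp: inaccessible_def)
  then show ?thesis
    by (auto simp: mem_Vset)
qed

lemma Vof_in_Vset: "a \<in> elts \<nu> \<Longrightarrow> Vof a \<in> Vset \<nu>"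
  unfolding Vof_def using hier_in_Vset empty_in_Vset by blast

lemma ordinal_in_Vset_iff: "ordinal a \<Longrightarrow> a \<in> Vset \<nu> \<longleftrightarrow> a \<in> elts \<nu>"
  using ordinal_in_Vset_imp_mem ordinal_subset_Vset inaccessible_ordinal by blast

text \<open>The graph of an injection is a relation on \<open>vun x y\<close> and hence lies in
  \<open>Vset \<nu>\<close>, so the level sees the same size comparisons as the universe.\<close>

lemma lepoll_iff_coded:
  assumes "x \<in> Vset \<nu>" "y \<in> Vset \<nu>"
  shows "elts x \<lesssim> elts y \<longleftrightarrow>
    (\<exists>f\<in>Vset \<nu>. (\<forall>u\<in>elts x. \<exists>v\<in>elts y. opair u v \<in> elts f) \<and>
      (\<forall>u\<in>elts x. \<forall>u'\<in>elts x. \<forall>v\<in>elts y.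
        opair u v \<in> elts f \<and> opair u' v \<in> elts f \<longrightarrow> u = u'))"
    (is "_ \<longleftrightarrow> ?R")
proof
  assume "elts x \<lesssim> elts y"
  then obtain g where g: "inj_on g (elts x)" "g ` elts x \<subseteq> elts y"
    by (auto simp: lepoll_def)
  obtain f where f: "elts f = (\<lambda>u. opair u (g u)) ` elts x"
    using replacement by blast
  have "f \<in> Vset \<nu>"
    by (rule relation_in_Vset[OF vun_in_Vset[OF assms]]) (use f g in auto)
  moreover have "\<forall>u\<in>elts x. \<exists>v\<in>elts y. opair u v \<in> elts f"
    using g by (auto simp: f)
  ultimately show ?R
    using g by (intro bexI[of _ f]) (auto simp: f inj_on_def)
next
  assume ?R
  \<comment> \<open>The code \<open>f\<close> is a total relation, possibly multivalued. Choosing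
    one value for each \<open>u\<close> gives a function, and it is injective because each
    \<open>v\<close> has at most one preimage.\<close>
  then obtain f g where "\<And>u. u \<in> elts x \<Longrightarrow> g u \<in> elts y \<and> opair u (g u) \<in> elts f"
    "\<And>u u' v. u \<in> elts x \<Longrightarrow> u' \<in> elts x \<Longrightarrow> v \<in> elts y \<Longrightarrow>
       opair u v \<in> elts f \<Longrightarrow> opair u' v \<in> elts f \<Longrightarrow> u = u'"
    by metis
  then have "inj_on g (elts x)" "g ` elts x \<subseteq> elts y"
    by (metis inj_onI, blast)
  then show "elts x \<lesssim> elts y"
    by (auto simp: lepoll_def)
qed

text \<open>The recursion is witnessed by a set \<open>f\<close> of pairs whose domain contains the
  members of its members and whose values satisfy the recursion equation relative to
  \<open>f\<close>. The graph of \<open>hier b\<close> up to \<open>g\<close> is such a set;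
  conversely, membership induction shows that every pair in any such \<open>f\<close> carries the
  true value.\<close>

lemma eq_hier_iff_coded:
  assumes "b \<in> Vset \<nu>" "g \<in> Vset \<nu>" "m \<in> Vset \<nu>" "ordinal g"
  shows "m = hier b g \<longleftrightarrow>
    (\<exists>f\<in>Vset \<nu>. opair g m \<in> elts f \<and>
      (\<forall>p\<in>elts f. \<exists>c\<in>Vset \<nu>. \<exists>w\<in>Vset \<nu>. p = opair c w \<and>
        (\<forall>d\<in>elts c. \<exists>v\<in>Vset \<nu>. opair d v \<in> elts f) \<and>
        (\<forall>x\<in>Vset \<nu>. x \<in> elts w \<longleftrightarrow>
           x \<in> elts b \<or> (\<exists>d\<in>elts c. \<exists>v\<in>Vset \<nu>. opair d v \<in> elts f \<and> elts x \<subseteq> elts v))))"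
    (is "_ \<longleftrightarrow> ?R")
proof
  assume m: "m = hier b g"
  \<comment> \<open>The domain \<open>s\<close> is \<open>g\<close> together with its members. Since
    \<open>hier b\<close> is increasing, all values are subsets of \<open>m\<close>; thus
    \<open>a\<close> contains both coordinates of every pair, as \<open>relation_in_Vset\<close>
    requires.\<close>
  define s where "s = vun g (upair g g)"
  define a where "a = vun s (vpow m)"
  have s: "elts s = insert g (elts g)" and sV: "s \<in> Vset \<nu>"
    using assms by (auto simp: s_def vun_in_Vset upair_in_Vset)
  have aV: "a \<in> Vset \<nu>"
    using sV assms by (simp add: a_def vun_in_Vset vpow_in_Vset)
  obtain f where f: "elts f = (\<lambda>c. opair c (hier b c)) ` elts s"
    using replacement by blast
  have h: "hier b c \<in> elts (vpow m)" if "c \<in> elts s" for c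
    using that hier_mono[OF \<open>ordinal g\<close>] by (auto simp: s m)
  have hV: "hier b c \<in> Vset \<nu>" if "c \<in> elts s" for c
    using h[OF that] vpow_in_Vset[OF assms(3)] Vset_mem_trans by blast
  have ds: "d \<in> elts s" if "c \<in> elts s" "d \<in> elts c" for c d
    using that ordinal_transD[OF \<open>ordinal g\<close>] by (auto simp: s)
  have "f \<in> Vset \<nu>"
    by (rule relation_in_Vset[OF aV]) (use h in \<open>auto simp: f a_def\<close>)
  moreover have "opair g m \<in> elts f"
    by (auto simp: f s m)
  moreover have "\<exists>c'\<in>Vset \<nu>. \<exists>w\<in>Vset \<nu>. opair c (hier b c) = opair c' w \<and>
        (\<forall>d\<in>elts c'. \<exists>v\<in>Vset \<nu>. opair d v \<in> elts f) \<and>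
        (\<forall>x\<in>Vset \<nu>. x \<in> elts w \<longleftrightarrow>
           x \<in> elts b \<or> (\<exists>d\<in>elts c'. \<exists>v\<in>Vset \<nu>. opair d v \<in> elts f \<and> elts x \<subseteq> elts v))"
    if c: "c \<in> elts s" for c
  proof (rule bexI[of _ c], rule bexI[of _ "hier b c"], intro conjI ballI refl)
    show "c \<in> Vset \<nu>"
      using c sV Vset_mem_trans by blast
    show "\<exists>v\<in>Vset \<nu>. opair d v \<in> elts f" if "d \<in> elts c" for d
      using ds[OF c that] hV by (auto simp: f)
    show "x \<in> elts (hier b c) \<longleftrightarrow>
           x \<in> elts b \<or> (\<exists>d\<in>elts c. \<exists>v\<in>Vset \<nu>. opair d v \<in> elts f \<and> elts x \<subseteq> elts v)" for x
      using ds[OF c] hV by (auto simp: f elts_hier[of b c])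
  qed (rule hV[OF c])
  ultimately show ?R
    by (intro bexI[of _ f] conjI) (auto simp: f)
next
  assume ?R
  then obtain f where gm: "opair g m \<in> elts f"
    and *: "\<And>p. p \<in> elts f \<Longrightarrow> \<exists>c\<in>Vset \<nu>. \<exists>w\<in>Vset \<nu>. p = opair c w \<and>
        (\<forall>d\<in>elts c. \<exists>v\<in>Vset \<nu>. opair d v \<in> elts f) \<and>
        (\<forall>x\<in>Vset \<nu>. x \<in> elts w \<longleftrightarrow>
           x \<in> elts b \<or> (\<exists>d\<in>elts c. \<exists>v\<in>Vset \<nu>. opair d v \<in> elts f \<and> elts x \<subseteq> elts v))"
    by blast
  have "w = hier b c" if "opair c w \<in> elts f" for c w
    using that
  proof (induction c arbitrary: w rule: elts_induct)
    case (step c)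
    from *[OF step.prems]
    have w: "w \<in> Vset \<nu>" and ex: "\<And>d. d \<in> elts c \<Longrightarrow> \<exists>v\<in>Vset \<nu>. opair d v \<in> elts f"
      and mem: "\<And>x. x \<in> Vset \<nu> \<Longrightarrow> x \<in> elts w \<longleftrightarrow>
           x \<in> elts b \<or> (\<exists>d\<in>elts c. \<exists>v\<in>Vset \<nu>. opair d v \<in> elts f \<and> elts x \<subseteq> elts v)"
      by auto
    have hV: "opair d (hier b d) \<in> elts f" "hier b d \<in> Vset \<nu>" if "d \<in> elts c" for d
      using ex[OF that] step.IH[OF that] by auto
    have "x \<in> elts w \<longleftrightarrow> x \<in> elts (hier b c)" for x
    proof -
      \<comment> \<open>The equation for \<open>w\<close> is only available for \<open>x\<close> in
        \<open>Vset \<nu>\<close>; members of either side lie there, so extensionality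
        applies.\<close>
      have "x \<in> Vset \<nu>" if "x \<in> elts w \<or> x \<in> elts (hier b c)"
        using that w assms(1) hV(2)
        by (auto simp: elts_hier[of b c] intro: Vset_mem_trans Vset_subset)
      moreover have "x \<in> elts b \<or> (\<exists>d\<in>elts c. \<exists>v\<in>Vset \<nu>. opair d v \<in> elts f \<and> elts x \<subseteq> elts v) \<longleftrightarrow>
          x \<in> elts (hier b c)"
        using hV step.IH by (fastforce simp: elts_hier[of b c])
      ultimately show ?thesis
        using mem by blast
    qed
    then show ?case
      using extensionality by blast
  qed
  with gm show "m = hier b g" by blast
qed

end


section \<open>Predicates definable at inaccessible levels\<close>

lemma sat_cong: "(\<And>i. i \<in> fv \<phi> \<Longrightarrow> e i = e' i) \<Longrightarrow> sat M e \<phi> = sat M e' \<phi>"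
proof (induction \<phi> arbitrary: e e')
  case (All i \<phi>)
  have "sat M (e(i := a)) \<phi> = sat M (e'(i := a)) \<phi>" for a
    by (rule All.IH) (use All.prems in auto)
  then show ?case by simp
next
  case (Conj \<phi> \<psi>)
  then show ?case by (metis UnCI fv.simps(4) sat.simps(4))
next
  case (Neg \<phi>)
  then show ?case by (metis fv.simps(3) sat.simps(3))
qed auto

lemma finite_fv: "finite (fv \<phi>)"
  by (induction \<phi>) auto

lemma models_All: "models M (All i \<phi>) = models M \<phi>"
proof
  assume "models M (All i \<phi>)"
  then show "models M \<phi>"
    unfolding models_def by (metis fun_upd_triv range_subsetD sat.simps(5))
next
  assume *: "models M \<phi>"
  have "sat M (e(i := a)) \<phi>" if "range e \<subseteq> M" "a \<in> M" for e a
    using * that by (auto simp: models_def fun_upd_def image_subset_iff)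
  then show "models M (All i \<phi>)"
    by (simp add: models_def)
qed

text \<open>\<open>models\<close> already quantifies over all valuations, so free variables can be
  bound one at a time without changing it.\<close>

lemma universal_closure: "\<exists>\<psi>. fv \<psi> = {} \<and> (\<forall>M :: 'v::zfc_universe set. models M \<psi> = models M \<phi>)"
proof -
  have "\<exists>\<psi>. fv \<psi> = {} \<and> (\<forall>M :: 'v set. models M \<psi> = models M \<phi>)" if "finite A" "fv \<phi> \<subseteq> A" for A \<phi>
    using that
  proof (induction A arbitrary: \<phi> rule: finite_induct)
    case (insert i A)
    then have "fv (All i \<phi>) \<subseteq> A" by auto
    from insert.IH[OF this] show ?case
      by (simp add: models_All)
  qed auto
  then show ?thesis
    using finite_fv by blast
qed

text \<open>Bound variables are renamed too; injectivity of \<open>r\<close> is what excludes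
  capture.\<close>

primrec rename :: "(nat \<Rightarrow> nat) \<Rightarrow> fm \<Rightarrow> fm" where
  "rename r (Mem i j) = Mem (r i) (r j)"
| "rename r (Equal i j) = Equal (r i) (r j)"
| "rename r (Neg \<phi>) = Neg (rename r \<phi>)"
| "rename r (Conj \<phi> \<psi>) = Conj (rename r \<phi>) (rename r \<psi>)"
| "rename r (All i \<phi>) = All (r i) (rename r \<phi>)"

lemma sat_rename: "inj r \<Longrightarrow> sat M e (rename r \<phi>) = sat M (e \<circ> r) \<phi>"
proof (induction \<phi> arbitrary: e)
  case (All i \<phi>)
  have "e(r i := a) \<circ> r = (e \<circ> r)(i := a)" for a
    using All.prems by (auto simp: inj_eq)
  then show ?case
    using All by (metis rename.simps(5) sat.simps(5))
qed auto

text \<open>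
  Predicates on valuations stand in for formulas. Quantifier rules use de Bruijn indexing (the
  bound variable becomes index 0), so that they apply by unification alone, without side
  conditions on fresh variables.
\<close>

definition definable :: "('v::zfc_universe \<Rightarrow> (nat \<Rightarrow> 'v) \<Rightarrow> bool) \<Rightarrow> bool" where
  "definable P \<longleftrightarrow> (\<exists>\<phi>. \<forall>\<nu> e. inaccessible \<nu> \<longrightarrow> range e \<subseteq> Vset \<nu> \<longrightarrow>
     (sat (Vset \<nu>) e \<phi> \<longleftrightarrow> P \<nu> e))"

text \<open>The entry point for all absoluteness arguments: a notion may be replaced by a version
  relativized to \<open>Vset \<nu>\<close> once the two agree at inaccessible \<open>\<nu>\<close>
  on parameters from that level.\<close>

lemma definable_cong:
  assumes "definable P"
    and "\<And>\<nu> e. inaccessible \<nu> \<Longrightarrow> (\<And>i. e i \<in> Vset \<nu>) \<Longrightarrow> P \<nu> e \<longleftrightarrow> Q \<nu> e"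
  shows "definable Q"
  using assms unfolding definable_def by (metis range_subsetD)

section \<open>Atomic formulas, connectives and quantifiers\<close>

lemma definable_mem: "definable (\<lambda>\<nu> e. e i \<in> elts (e j))"
  unfolding definable_def by (rule exI[of _ "Mem i j"]) simp

lemma definable_eq: "definable (\<lambda>\<nu> e. e i = e j)"
  unfolding definable_def by (rule exI[of _ "Equal i j"]) simp

lemma definable_not: "definable P \<Longrightarrow> definable (\<lambda>\<nu> e. \<not> P \<nu> e)"
  unfolding definable_def by (metis sat.simps(3))

lemma definable_conj:
  "definable P \<Longrightarrow> definable Q \<Longrightarrow> definable (\<lambda>\<nu> e. P \<nu> e \<and> Q \<nu> e)"
  unfolding definable_def by (metis sat.simps(4))

lemma definable_disj:
  assumes "definable P" "definable Q"
  shows "definable (\<lambda>\<nu> e. P \<nu> e \<or> Q \<nu> e)"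
  using definable_not[OF definable_conj[OF assms[THEN definable_not]]] by simp

lemma definable_imp:
  assumes "definable P" "definable Q"
  shows "definable (\<lambda>\<nu> e. P \<nu> e \<longrightarrow> Q \<nu> e)"
  using definable_disj[OF definable_not[OF assms(1)] assms(2)] by (simp add: disj_imp)

lemma definable_iff:
  assumes "definable P" "definable Q"
  shows "definable (\<lambda>\<nu> e. P \<nu> e \<longleftrightarrow> Q \<nu> e)"
  using definable_conj[OF definable_imp[OF assms] definable_imp[OF assms(2,1)]]
  unfolding iff_conv_conj_imp .

lemma definable_all:
  assumes "definable (\<lambda>\<nu> e. P \<nu> (e 0) (\<lambda>n. e (Suc n)))"
  shows "definable (\<lambda>\<nu> e. \<forall>a\<in>Vset \<nu>. P \<nu> a e)"
proof -
  obtain \<phi> where \<phi>: "\<And>\<nu> e. inaccessible \<nu> \<Longrightarrow> range e \<subseteq> Vset \<nu> \<Longrightarrow>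
      sat (Vset \<nu>) e \<phi> \<longleftrightarrow> P \<nu> (e 0) (\<lambda>n. e (Suc n))"
    using assms unfolding definable_def by blast
  obtain N where N: "\<And>i. i \<in> fv \<phi> \<Longrightarrow> i \<le> N"
    using finite_fv finite_nat_set_iff_bounded_le by metis
  \<comment> \<open>Index 0 moves to the named variable \<open>N\<close>, the indices from 1 to
    \<open>N\<close> move down by one, and larger indices, which are not free in
    \<open>\<phi>\<close>, stay. This is injective, and binding \<open>N\<close> then overwrites
    only what index 0 reads.\<close>
  define r where "r = (\<lambda>n. if n = 0 then N else if n \<le> N then n - 1 else n)"
  have r: "inj r"
    by (rule injI) (auto simp: r_def split: if_splits)
  have "sat (Vset \<nu>) e (All N (rename r \<phi>)) \<longleftrightarrow> (\<forall>a\<in>Vset \<nu>. P \<nu> a e)"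
    if \<nu>: "inaccessible \<nu>" and e: "range e \<subseteq> Vset \<nu>" for \<nu> e
  proof -
    have "sat (Vset \<nu>) (e(N := a)) (rename r \<phi>) \<longleftrightarrow> P \<nu> a e" if a: "a \<in> Vset \<nu>" for a
    proof -
      have "sat (Vset \<nu>) (e(N := a)) (rename r \<phi>) \<longleftrightarrow> sat (Vset \<nu>) (case_nat a e) \<phi>"
        unfolding sat_rename[OF r]
        by (rule sat_cong) (auto simp: r_def dest: N split: nat.split)
      also have "\<dots> \<longleftrightarrow> P \<nu> a e"
        using \<phi>[OF \<nu>, of "case_nat a e"] a e by (auto split: nat.split simp: image_subset_iff)
      finally show ?thesis .
    qed
    then show ?thesis by simp
  qed
  then show ?thesis
    unfolding definable_def by blast
qed

lemma definable_ex:
  assumes "definable (\<lambda>\<nu> e. P \<nu> (e 0) (\<lambda>n. e (Suc n)))"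
  shows "definable (\<lambda>\<nu> e. \<exists>a\<in>Vset \<nu>. P \<nu> a e)"
  using definable_not[OF definable_all[of "\<lambda>\<nu> a e. \<not> P \<nu> a e", OF definable_not[OF assms]]]
  by simp

text \<open>The level is transitive, so a quantifier over members of \<open>e i\<close> is a
  relativized quantifier over the level.\<close>

lemma definable_ball:
  assumes "definable (\<lambda>\<nu> e. P \<nu> (e 0) (\<lambda>n. e (Suc n)))"
  shows "definable (\<lambda>\<nu> e. \<forall>a\<in>elts (e i). P \<nu> a e)"
proof (rule definable_cong)
  show "definable (\<lambda>\<nu> e. \<forall>a\<in>Vset \<nu>. a \<in> elts (e i) \<longrightarrow> P \<nu> a e)"
    by (intro definable_all definable_imp definable_mem assms)
qed (use Vset_mem_trans in blast)

lemma definable_bex: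
  assumes "definable (\<lambda>\<nu> e. P \<nu> (e 0) (\<lambda>n. e (Suc n)))"
  shows "definable (\<lambda>\<nu> e. \<exists>a\<in>elts (e i). P \<nu> a e)"
  using definable_not[OF definable_ball[of "\<lambda>\<nu> a e. \<not> P \<nu> a e", OF definable_not[OF assms]]]
  by simp

lemma definable_subset: "definable (\<lambda>\<nu> e. elts (e i) \<subseteq> elts (e j))"
  unfolding subset_eq by (intro definable_ball definable_mem)

lemmas definable_basic =
  definable_mem definable_eq definable_not definable_conj definable_disj definable_imp
  definable_iff definable_all definable_ex definable_ball definable_bex definable_subset

section \<open>Pairs and comparison of cardinalities\<close>

lemma definable_upair: "definable (\<lambda>\<nu> e. e i = upair (e j) (e k))"
proof (rule definable_cong)
  show "definable (\<lambda>\<nu> e. \<forall>z\<in>Vset \<nu>. z \<in> elts (e i) \<longleftrightarrow> z = e j \<or> z = e k)"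
    by (intro definable_basic)
next
  fix \<nu> :: 'a and e :: "nat \<Rightarrow> 'a"
  assume "inaccessible \<nu>" "\<And>i. e i \<in> Vset \<nu>"
  then have "e i = upair (e j) (e k) \<longleftrightarrow> elts (e i) = {e j, e k}" "elts (e i) \<subseteq> Vset \<nu>"
    using Vset_mem_trans by (auto simp flip: elts_inject)
  then show "(\<forall>z\<in>Vset \<nu>. z \<in> elts (e i) \<longleftrightarrow> z = e j \<or> z = e k) \<longleftrightarrow> e i = upair (e j) (e k)"
    using \<open>\<And>i. e i \<in> Vset \<nu>\<close> by blast
qed

lemma definable_opair: "definable (\<lambda>\<nu> e. e i = opair (e j) (e k))"
proof (rule definable_cong)
  show "definable (\<lambda>\<nu> e. \<exists>a\<in>Vset \<nu>. \<exists>b\<in>Vset \<nu>.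
      a = upair (e j) (e j) \<and> b = upair (e j) (e k) \<and> e i = upair a b)"
    by (intro definable_basic definable_upair)
qed (auto simp: opair_def upair_in_Vset)

lemma definable_opair_mem: "definable (\<lambda>\<nu> e. opair (e i) (e j) \<in> elts (e k))"
proof (rule definable_cong)
  show "definable (\<lambda>\<nu> e. \<exists>p\<in>elts (e k). p = opair (e i) (e j))"
    by (intro definable_basic definable_opair)
qed auto

lemma definable_lepoll: "definable (\<lambda>\<nu> e. elts (e i) \<lesssim> elts (e j))"
proof (rule definable_cong)
  show "definable (\<lambda>\<nu> e. \<exists>f\<in>Vset \<nu>. (\<forall>u\<in>elts (e i). \<exists>v\<in>elts (e j). opair u v \<in> elts f) \<and>
      (\<forall>u\<in>elts (e i). \<forall>u'\<in>elts (e i). \<forall>v\<in>elts (e j).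
        opair u v \<in> elts f \<and> opair u' v \<in> elts f \<longrightarrow> u = u'))"
    by (intro definable_basic definable_opair_mem)
qed (use lepoll_iff_coded in blast)

text \<open>Schroeder-Bernstein: strict comparison reduces to existence of injections, which is
  already coded.\<close>

lemma lesspoll_iff_lepoll: "A \<prec> B \<longleftrightarrow> A \<lesssim> B \<and> \<not> B \<lesssim> A"
  by (metis eqpoll_imp_lepoll eqpoll_sym lepoll_antisym lesspoll_def)

lemma definable_lesspoll: "definable (\<lambda>\<nu> e. elts (e i) \<prec> elts (e j))"
  unfolding lesspoll_iff_lepoll by (intro definable_basic definable_lepoll)

text \<open>Dedekind's criterion, which expresses infinity by injections alone, with no reference to
  the natural numbers.\<close>

lemma infinite_iff_lepoll_psubset: "infinite A \<longleftrightarrow> (\<exists>B. B \<subset> A \<and> A \<lesssim> B)"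
proof
  assume A: "infinite A"
  then obtain a where "a \<in> A"
    by (metis finite.emptyI ex_in_conv)
  then have "A \<lesssim> A - {a}"
    using infinite_insert_eqpoll[of "A - {a}" a] A eqpoll_imp_lepoll by (simp add: insert_absorb)
  then show "\<exists>B. B \<subset> A \<and> A \<lesssim> B"
    using \<open>a \<in> A\<close> by blast
next
  assume "\<exists>B. B \<subset> A \<and> A \<lesssim> B"
  then obtain B where B: "B \<subset> A" "A \<lesssim> B" by blast
  have "card A \<le> card B" "card B < card A" if "finite A"
    using B that finite_subset[of B A] by (auto simp: psubset_card_mono lepoll_iff_card_le)
  then show "infinite A" by fastforce
qed

text \<open>Forward, \<open>B\<close> is a countably infinite subset. Backward, a countable
  \<open>A\<close> injects into the naturals and hence into every infinite \<open>B\<close>.\<close>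

lemma uncountable_iff_lepoll: "uncountable A \<longleftrightarrow> (\<exists>B\<subseteq>A. infinite B \<and> \<not> A \<lesssim> B)"
proof
  assume A: "uncountable A"
  then obtain f :: "nat \<Rightarrow> 'a" where f: "inj f" "range f \<subseteq> A"
    using infinite_countable_subset[OF uncountable_infinite[OF A]] by blast
  then have "infinite (range f)" "\<not> A \<lesssim> range f"
    using A countable_lepoll[of "range f" A] by (auto simp: finite_image_iff)
  then show "\<exists>B\<subseteq>A. infinite B \<and> \<not> A \<lesssim> B"
    using f by blast
next
  assume "\<exists>B\<subseteq>A. infinite B \<and> \<not> A \<lesssim> B"
  moreover have "A \<lesssim> (UNIV :: nat set)" if "countable A"
    using that by (auto simp: countable_def lepoll_def)
  ultimately show "uncountable A"
    using lepoll_trans[of A "UNIV :: nat set"] by (auto simp: infinite_le_lepoll)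
qed

lemma definable_infinite: "definable (\<lambda>\<nu> e. infinite (elts (e i)))"
proof (rule definable_cong)
  show "definable (\<lambda>\<nu> e. \<exists>y\<in>Vset \<nu>. elts y \<subseteq> elts (e i) \<and> \<not> elts (e i) \<subseteq> elts y \<and>
      elts (e i) \<lesssim> elts y)"
    by (intro definable_basic definable_lepoll)
qed (metis infinite_iff_lepoll_psubset small_subset Vset_subset psubset_eq subset_antisym)

lemma definable_uncountable: "definable (\<lambda>\<nu> e. uncountable (elts (e i)))"
proof (rule definable_cong)
  show "definable (\<lambda>\<nu> e. \<exists>y\<in>Vset \<nu>. elts y \<subseteq> elts (e i) \<and> infinite (elts y) \<and>
      \<not> elts (e i) \<lesssim> elts y)"
    by (intro definable_conj definable_ex definable_subset definable_infinite
        definable_not[OF definable_lepoll])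
qed (metis uncountable_iff_lepoll small_subset Vset_subset)

section \<open>Inaccessibility as a definable predicate\<close>

lemma definable_ordinal: "definable (\<lambda>\<nu> e. ordinal (e i))"
  unfolding ordinal_def transitive_def by (intro definable_basic)

lemma definable_cardinal: "definable (\<lambda>\<nu> e. cardinal (e i))"
  unfolding cardinal_def by (intro definable_basic definable_ordinal definable_lesspoll)

lemma definable_regular: "definable (\<lambda>\<nu> e. regular (e i))"
proof (rule definable_cong)
  show "definable (\<lambda>\<nu> e. \<forall>z\<in>Vset \<nu>. elts z \<subseteq> elts (e i) \<and> elts z \<prec> elts (e i) \<longrightarrow>
      (\<exists>\<beta>\<in>elts (e i). elts z \<subseteq> elts \<beta>))"
    by (intro definable_basic definable_lesspoll)
next
  fix \<nu> :: 'a and e :: "nat \<Rightarrow> 'a"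
  assume "\<And>i. e i \<in> Vset \<nu>"
  from all_subset_iff_Vset[OF this, of i "\<lambda>X. X \<prec> elts (e i) \<longrightarrow> (\<exists>\<beta>\<in>elts (e i). X \<subseteq> elts \<beta>)"]
  show "(\<forall>z\<in>Vset \<nu>. elts z \<subseteq> elts (e i) \<and> elts z \<prec> elts (e i) \<longrightarrow>
      (\<exists>\<beta>\<in>elts (e i). elts z \<subseteq> elts \<beta>)) \<longleftrightarrow> regular (e i)"
    unfolding regular_def by (simp add: imp_conjL)
qed

text \<open>\<open>elts\<close> is a bijection between the subsets of \<open>x\<close> as elements
  of the universe and its HOL subsets; this links \<open>strong_limit\<close>, stated with
  \<open>Pow\<close>, to an object that formulas can mention.\<close>

lemma Pow_eqpoll_vpow: "Pow (elts x) \<approx> elts (vpow (x :: 'v::zfc_universe))"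
proof -
  have "inj_on elts (elts (vpow x))"
    by (simp add: inj_on_def elts_inject)
  moreover have "elts ` elts (vpow x) = Pow (elts x)"
  proof (intro equalityI subsetI)
    fix X assume "X \<in> Pow (elts x)"
    moreover from this obtain z where "elts z = X"
      using small_subset by blast
    ultimately show "X \<in> elts ` elts (vpow x)" by auto
  qed auto
  ultimately have "bij_betw elts (elts (vpow x)) (Pow (elts x))"
    by (simp add: bij_betw_def)
  then show ?thesis
    using eqpoll_def eqpoll_sym by blast
qed

lemma definable_strong_limit: "definable (\<lambda>\<nu> e. strong_limit (e i))"
proof (rule definable_cong)
  show "definable (\<lambda>\<nu> e. \<forall>\<beta>\<in>elts (e i). \<exists>p\<in>Vset \<nu>.
      (\<forall>z\<in>Vset \<nu>. z \<in> elts p \<longleftrightarrow> elts z \<subseteq> elts \<beta>) \<and> elts p \<prec> elts (e i))"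
    by (intro definable_basic definable_lesspoll)
next
  fix \<nu> :: 'a and e :: "nat \<Rightarrow> 'a"
  assume \<nu>: "inaccessible \<nu>" and e: "\<And>i. e i \<in> Vset \<nu>"
  have "(\<exists>p\<in>Vset \<nu>. (\<forall>z\<in>Vset \<nu>. z \<in> elts p \<longleftrightarrow> elts z \<subseteq> elts \<beta>) \<and> elts p \<prec> elts (e i)) \<longleftrightarrow>
      Pow (elts \<beta>) \<prec> elts (e i)" if "\<beta> \<in> elts (e i)" for \<beta>
  proof -
    have \<beta>: "\<beta> \<in> Vset \<nu>"
      using Vset_mem_trans[OF \<nu> e that] .
    \<comment> \<open>Testing \<open>z\<close> in the level suffices: members of \<open>p\<close>
      lie there by transitivity, and subsets of \<open>\<beta>\<close> by closure under
      subsets.\<close>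
    have "(\<forall>z\<in>Vset \<nu>. z \<in> elts p \<longleftrightarrow> elts z \<subseteq> elts \<beta>) \<longleftrightarrow> p = vpow \<beta>" if "p \<in> Vset \<nu>" for p
      using Vset_mem_trans[OF \<nu> that] Vset_subset[OF \<beta>]
      by (auto simp flip: elts_inject)
    then have "(\<exists>p\<in>Vset \<nu>. (\<forall>z\<in>Vset \<nu>. z \<in> elts p \<longleftrightarrow> elts z \<subseteq> elts \<beta>) \<and> elts p \<prec> elts (e i)) \<longleftrightarrow>
        elts (vpow \<beta>) \<prec> elts (e i)"
      using vpow_in_Vset[OF \<nu> \<beta>] by blast
    also have "\<dots> \<longleftrightarrow> Pow (elts \<beta>) \<prec> elts (e i)"
      by (rule iffI; erule eq_lesspoll_trans[rotated])
        (rule Pow_eqpoll_vpow Pow_eqpoll_vpow[THEN eqpoll_sym])+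
    finally show ?thesis .
  qed
  then show "(\<forall>\<beta>\<in>elts (e i). \<exists>p\<in>Vset \<nu>.
      (\<forall>z\<in>Vset \<nu>. z \<in> elts p \<longleftrightarrow> elts z \<subseteq> elts \<beta>) \<and> elts p \<prec> elts (e i)) \<longleftrightarrow> strong_limit (e i)"
    by (simp add: strong_limit_def)
qed

lemma definable_inaccessible: "definable (\<lambda>\<nu> e. inaccessible (e i))"
  unfolding inaccessible_def
  by (intro definable_conj definable_cardinal definable_uncountable definable_regular
      definable_strong_limit)

text \<open>The conjunct \<open>ordinal (e k)\<close> supplies the hypothesis on the index under
  which \<open>eq_hier_iff_coded\<close> holds.\<close>

lemma definable_hier: "definable (\<lambda>\<nu> e. ordinal (e k) \<and> e i = hier (e j) (e k))"
proof (rule definable_cong)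
  show "definable (\<lambda>\<nu> e. ordinal (e k) \<and> (\<exists>f\<in>Vset \<nu>. opair (e k) (e i) \<in> elts f \<and>
      (\<forall>p\<in>elts f. \<exists>c\<in>Vset \<nu>. \<exists>w\<in>Vset \<nu>. p = opair c w \<and>
        (\<forall>d\<in>elts c. \<exists>v\<in>Vset \<nu>. opair d v \<in> elts f) \<and>
        (\<forall>x\<in>Vset \<nu>. x \<in> elts w \<longleftrightarrow>
           x \<in> elts (e j) \<or>
           (\<exists>d\<in>elts c. \<exists>v\<in>Vset \<nu>. opair d v \<in> elts f \<and> elts x \<subseteq> elts v)))))"
    by (intro definable_basic definable_ordinal definable_opair definable_opair_mem)
qed (rule conj_cong[OF refl], rule eq_hier_iff_coded[symmetric], simp_all)

lemma definable_Vof: "definable (\<lambda>\<nu> e. ordinal (e j) \<and> e i = Vof (e j))"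
proof (rule definable_cong)
  show "definable (\<lambda>\<nu> e. \<exists>b\<in>Vset \<nu>. (\<forall>x\<in>Vset \<nu>. x \<notin> elts b) \<and>
      (ordinal (e j) \<and> e i = hier b (e j)))"
    by (intro definable_ex definable_conj definable_all definable_not definable_mem definable_hier)
next
  fix \<nu> :: 'a and e :: "nat \<Rightarrow> 'a"
  assume \<nu>: "inaccessible \<nu>"
  have "(\<forall>x\<in>Vset \<nu>. x \<notin> elts b) \<longleftrightarrow> b = set_of {}" if "b \<in> Vset \<nu>" for b
    using Vset_mem_trans[OF \<nu> that] by (auto simp flip: elts_inject)
  then show "(\<exists>b\<in>Vset \<nu>. (\<forall>x\<in>Vset \<nu>. x \<notin> elts b) \<and> (ordinal (e j) \<and> e i = hier b (e j))) \<longleftrightarrow>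
      ordinal (e j) \<and> e i = Vof (e j)"
    using empty_in_Vset[OF \<nu>] by (auto simp: Vof_def)
qed

lemma definable_absolutely_definable:
  assumes "absolutely_definable \<alpha>"
  shows "definable (\<lambda>\<nu> e. e i = \<alpha>)"
proof -
  obtain \<psi> where \<psi>: "fv \<psi> \<subseteq> {0}"
    "\<And>\<nu> x. inaccessible \<nu> \<Longrightarrow> x \<in> Vset \<nu> \<Longrightarrow> sat (Vset \<nu>) (\<lambda>_. x) \<psi> \<longleftrightarrow> x = \<alpha>"
    using assms unfolding absolutely_definable_def by blast
  have "sat M e \<psi> = sat M (\<lambda>_. e 0) \<psi>" for M and e :: "nat \<Rightarrow> 'a"
    by (rule sat_cong) (use \<psi>(1) in auto)
  then have "definable (\<lambda>\<nu> e. e 0 = \<alpha>)"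
    unfolding definable_def using \<psi>(2) by (metis range_subsetD)
  \<comment> \<open>The defining formula speaks about variable 0. Quantifying a copy
    \<open>a\<close> of \<open>e i\<close> puts the value at index 0.\<close>
  then have "definable (\<lambda>\<nu> e. \<exists>a\<in>Vset \<nu>. a = e i \<and> a = \<alpha>)"
    by (intro definable_ex definable_conj definable_eq)
  then show ?thesis
    by (rule definable_cong) auto
qed


section \<open>Satisfaction in set-sized structures\<close>

lemma so_sat_cong:
  "(\<And>i. i \<in> so_fv \<phi> \<Longrightarrow> e i = e' i) \<Longrightarrow> (\<And>i. i \<in> so_set_fv \<phi> \<Longrightarrow> s i = s' i) \<Longrightarrow>
    so_sat M e s \<phi> = so_sat M e' s' \<phi>"
proof (induction \<phi> arbitrary: e e' s s')
  case (SAll i \<phi>)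
  have "so_sat M (e(i := a)) s \<phi> = so_sat M (e'(i := a)) s' \<phi>" for a
    by (rule SAll.IH) (use SAll.prems in auto)
  then show ?case by simp
next
  case (SAllSet i \<phi>)
  have "so_sat M e (s(i := a)) \<phi> = so_sat M e' (s'(i := a)) \<phi>" for a
    by (rule SAllSet.IH) (use SAllSet.prems in auto)
  then show ?case by simp
next
  case (SConj \<phi> \<psi>)
  have "so_sat M e s \<phi> = so_sat M e' s' \<phi>" "so_sat M e s \<psi> = so_sat M e' s' \<psi>"
    by (rule SConj.IH; use SConj.prems in simp)+
  then show ?case by simp
next
  case (SNeg \<phi>)
  have "so_sat M e s \<phi> = so_sat M e' s' \<phi>"
    by (rule SNeg.IH) (use SNeg.prems in auto)
  then show ?case by simp
qed auto

lemma ho_sat_cong: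
  "(\<And>i. i \<in> ho_fv \<phi> \<Longrightarrow> e i = e' i) \<Longrightarrow> ho_sat M B e \<phi> = ho_sat M B e' \<phi>"
proof (induction \<phi> arbitrary: e e')
  case (HAll i \<phi>)
  have "ho_sat M B (e(i := a)) \<phi> = ho_sat M B (e'(i := a)) \<phi>" for a
    by (rule HAll.IH) (use HAll.prems in auto)
  then show ?case by simp
next
  case (HConj \<phi> \<psi>)
  have "ho_sat M B e \<phi> = ho_sat M B e' \<phi>" "ho_sat M B e \<psi> = ho_sat M B e' \<psi>"
    by (rule HConj.IH; use HConj.prems in simp)+
  then show ?case by simp
next
  case (HNeg \<phi>)
  have "ho_sat M B e \<phi> = ho_sat M B e' \<phi>"
    by (rule HNeg.IH) (use HNeg.prems in auto)
  then show ?case by simp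
qed auto

text \<open>For a sentence, constant valuations suffice. Letting \<open>x\<close> range over
  \<open>M\<close> yields a bounded quantifier and keeps both sides vacuous when \<open>M\<close> is
  empty.\<close>

lemma models_sentence:
  "fv \<sigma> = {} \<Longrightarrow> models M \<sigma> \<longleftrightarrow> (\<forall>x\<in>M. sat M (\<lambda>_. x) \<sigma>)"
  unfolding models_def using sat_cong[of \<sigma>] by (smt (verit) empty_iff image_subset_iff range_subsetD)

text \<open>Transitivity of \<open>M\<close> makes \<open>elts x\<close> an admissible value for set
  variables, so the single element \<open>x\<close> provides both valuations.\<close>

lemma so_models_sentence:
  assumes "so_fv \<sigma> = {}" "so_set_fv \<sigma> = {}" "\<And>x. x \<in> M \<Longrightarrow> elts x \<subseteq> M"
  shows "so_models M \<sigma> \<longleftrightarrow> (\<forall>x\<in>M. so_sat M (\<lambda>_. x) (\<lambda>_. elts x) \<sigma>)"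
proof -
  have "so_sat M e s \<sigma> = so_sat M e' s' \<sigma>" for e s e' s'
    by (rule so_sat_cong) (use assms in auto)
  then show ?thesis
    unfolding so_models_def using assms(3) by (smt (verit) image_subset_iff range_subsetD)
qed

lemma ho_models_sentence:
  "ho_fv \<sigma> = {} \<Longrightarrow> ho_models M B \<sigma> \<longleftrightarrow> (\<forall>x\<in>M. ho_sat M B (\<lambda>_. x) \<sigma>)"
  unfolding ho_models_def using ho_sat_cong[of \<sigma>]
  by (smt (verit) empty_iff image_subset_iff range_subsetD)

text \<open>After a quantifier rule the bound element is index 0 and the old indices are shifted.
  The updated valuation is again a reindexing of \<open>e\<close>, which is the shape of the
  induction hypotheses below.\<close>

lemma valuation_upd:
  "(\<lambda>n. e (Suc (r n)))(k := e 0) = (\<lambda>n. e (if n = k then 0 else Suc (r n)))"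
  by auto

lemma set_valuation_upd:
  "(\<lambda>n. elts (e (Suc (s n))))(k := elts (e 0)) = (\<lambda>n. elts (e (if n = k then 0 else Suc (s n))))"
  by (auto simp: fun_eq_iff)

text \<open>External induction on \<open>\<sigma>\<close> relativizes its quantifiers to
  \<open>e i\<close>; the map \<open>r\<close> records where the variables of
  \<open>\<sigma>\<close> are stored in \<open>e\<close>.\<close>

lemma definable_sat: "definable (\<lambda>\<nu> e. sat (elts (e i)) (\<lambda>k. e (r k)) \<sigma>)"
proof (induction \<sigma> arbitrary: i r)
  case (All k \<sigma>)
  show ?case
    unfolding sat.simps
    by (rule definable_ball) (unfold valuation_upd, rule All.IH)
qed (unfold sat.simps; intro definable_basic; assumption)+

text \<open>Set variables are represented by elements through \<open>elts\<close>. All subsets of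
  \<open>e i\<close> occur in the ambient level, so set quantifiers become first-order.\<close>

lemma definable_so_sat:
  "definable (\<lambda>\<nu> e :: nat \<Rightarrow> 'v::zfc_universe.
     so_sat (elts (e i)) (\<lambda>k. e (r k)) (\<lambda>k. elts (e (s k))) \<sigma>)"
proof (induction \<sigma> arbitrary: i r s)
  case (SAll k \<sigma>)
  show ?case
    unfolding so_sat.simps
    by (rule definable_ball) (unfold valuation_upd, rule SAll.IH)
next
  case (SAllSet k \<sigma>)
  show ?case
  proof (rule definable_cong)
    show "definable (\<lambda>\<nu> e :: nat \<Rightarrow> 'v. \<forall>a\<in>Vset \<nu>. elts a \<subseteq> elts (e i) \<longrightarrow>
        so_sat (elts (e i)) (\<lambda>k. e (r k)) ((\<lambda>k. elts (e (s k)))(k := elts a)) \<sigma>)"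
      by (rule definable_all, rule definable_imp, rule definable_subset)
        (unfold set_valuation_upd, rule SAllSet.IH)
  qed (unfold so_sat.simps, subst all_subset_iff_Vset, auto)
qed (unfold so_sat.simps; intro definable_basic; assumption)+

lemma definable_ho_sat:
  "definable (\<lambda>\<nu> e. ho_sat (elts (e i)) (elts (e j)) (\<lambda>k. e (r k)) \<sigma>)"
proof (induction \<sigma> arbitrary: i j r)
  case (HAll k \<sigma>)
  show ?case
    unfolding ho_sat.simps
    by (rule definable_ball) (unfold valuation_upd, rule HAll.IH)
qed (unfold ho_sat.simps; intro definable_basic; assumption)+

text \<open>An inaccessible \<open>e i\<close> in the level of \<open>\<nu>\<close> is below
  \<open>\<nu>\<close>, so \<open>Vof (e i)\<close> is available there as a witness.\<close>

lemma definable_models: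
  fixes i :: nat
  assumes "fv \<sigma> = {}"
  shows "definable (\<lambda>\<nu> e :: nat \<Rightarrow> 'v::zfc_universe. inaccessible (e i) \<and> models (Vset (e i)) \<sigma>)"
proof (rule definable_cong)
  show "definable (\<lambda>\<nu> e :: nat \<Rightarrow> 'v. inaccessible (e i) \<and>
      (\<exists>b\<in>Vset \<nu>. (ordinal (e i) \<and> b = Vof (e i)) \<and> (\<forall>x\<in>elts b. sat (elts b) (\<lambda>_. x) \<sigma>)))"
    by (intro definable_conj definable_inaccessible definable_ex definable_Vof definable_ball
        definable_sat)
next
  fix \<nu> :: 'v and e :: "nat \<Rightarrow> 'v"
  assume \<nu>: "inaccessible \<nu>" and e: "\<And>i. e i \<in> Vset \<nu>"
  show "inaccessible (e i) \<and>
      (\<exists>b\<in>Vset \<nu>. (ordinal (e i) \<and> b = Vof (e i)) \<and> (\<forall>x\<in>elts b. sat (elts b) (\<lambda>_. x) \<sigma>)) \<longleftrightarrow>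
      inaccessible (e i) \<and> models (Vset (e i)) \<sigma>"
    using e[of i] Vof_in_Vset[OF \<nu>] ordinal_in_Vset_iff[OF \<nu>] inaccessible_ordinal
    by (auto simp: models_sentence[OF assms])
qed

lemma definable_so_models:
  fixes i :: nat
  assumes "so_fv \<sigma> = {}" "so_set_fv \<sigma> = {}"
  shows "definable (\<lambda>\<nu> e :: nat \<Rightarrow> 'v::zfc_universe. inaccessible (e i) \<and> so_models (Vset (e i)) \<sigma>)"
proof (rule definable_cong)
  show "definable (\<lambda>\<nu> e :: nat \<Rightarrow> 'v. inaccessible (e i) \<and>
      (\<exists>b\<in>Vset \<nu>. (ordinal (e i) \<and> b = Vof (e i)) \<and>
        (\<forall>x\<in>elts b. so_sat (elts b) (\<lambda>_. x) (\<lambda>_. elts x) \<sigma>)))"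
    by (intro definable_conj definable_inaccessible definable_ex definable_Vof definable_ball
        definable_so_sat)
next
  fix \<nu> :: 'v and e :: "nat \<Rightarrow> 'v"
  assume \<nu>: "inaccessible \<nu>" and e: "\<And>i. e i \<in> Vset \<nu>"
  have "so_models (Vset (e i)) \<sigma> \<longleftrightarrow>
      (\<forall>x\<in>Vset (e i). so_sat (Vset (e i)) (\<lambda>_. x) (\<lambda>_. elts x) \<sigma>)" if "inaccessible (e i)"
    using so_models_sentence[OF assms] Vset_trans inaccessible_ordinal[OF that] by blast
  then show "inaccessible (e i) \<and> (\<exists>b\<in>Vset \<nu>. (ordinal (e i) \<and> b = Vof (e i)) \<and>
        (\<forall>x\<in>elts b. so_sat (elts b) (\<lambda>_. x) (\<lambda>_. elts x) \<sigma>)) \<longleftrightarrow>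
      inaccessible (e i) \<and> so_models (Vset (e i)) \<sigma>"
    using e[of i] Vof_in_Vset[OF \<nu>] ordinal_in_Vset_iff[OF \<nu>] inaccessible_ordinal
    by auto
qed

text \<open>The witnesses are \<open>\<alpha>\<close>, fixed by its absolute definition, the base
  \<open>Vof (e i)\<close>, and the stage \<open>\<alpha>\<close> of the hierarchy built on it. All
  of them lie in \<open>Vset \<nu>\<close>.\<close>

lemma definable_ho_models:
  fixes i :: nat and \<alpha> :: "'v::zfc_universe"
  assumes "ho_fv \<sigma> = {}" "absolutely_definable \<alpha>"
  shows "definable (\<lambda>\<nu> e. inaccessible (e i) \<and> ho_models (Vset (oadd (e i) \<alpha>)) (Vset (e i)) \<sigma>)"
proof (rule definable_cong)
  show "definable (\<lambda>\<nu> e. inaccessible (e i) \<and> (\<exists>a\<in>Vset \<nu>. \<exists>b\<in>Vset \<nu>. \<exists>m\<in>Vset \<nu>. a = \<alpha> \<and>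
      (ordinal (e i) \<and> b = Vof (e i)) \<and> (ordinal a \<and> m = hier b a) \<and>
      (\<forall>x\<in>elts m. ho_sat (elts m) (elts b) (\<lambda>_. x) \<sigma>)))"
    by (intro definable_conj definable_inaccessible definable_ex definable_Vof definable_ball
        definable_hier definable_absolutely_definable[OF assms(2)] definable_ho_sat)
next
  fix \<nu> :: 'v and e :: "nat \<Rightarrow> 'v"
  assume \<nu>: "inaccessible \<nu>" and e: "\<And>i. e i \<in> Vset \<nu>"
  have \<alpha>: "ordinal \<alpha>" "\<alpha> \<in> Vset \<nu>"
    using assms(2) \<nu> by (auto simp: absolutely_definable_def)
  have ei: "ordinal (e i)" "Vof (e i) \<in> Vset \<nu>" if "inaccessible (e i)"
    using that e[of i] Vof_in_Vset[OF \<nu>] ordinal_in_Vset_iff[OF \<nu>] inaccessible_ordinal by blast+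
  have "hier (Vof (e i)) \<alpha> \<in> Vset \<nu>" if "inaccessible (e i)"
    using hier_in_Vset[OF \<nu> ei(2)[OF that]] \<alpha> ordinal_in_Vset_iff[OF \<nu>] by blast
  then show "inaccessible (e i) \<and> (\<exists>a\<in>Vset \<nu>. \<exists>b\<in>Vset \<nu>. \<exists>m\<in>Vset \<nu>. a = \<alpha> \<and>
      (ordinal (e i) \<and> b = Vof (e i)) \<and> (ordinal a \<and> m = hier b a) \<and>
      (\<forall>x\<in>elts m. ho_sat (elts m) (elts b) (\<lambda>_. x) \<sigma>)) \<longleftrightarrow>
      inaccessible (e i) \<and> ho_models (Vset (oadd (e i) \<alpha>)) (Vset (e i)) \<sigma>"
    using \<alpha> ei by (auto simp: ho_models_sentence[OF assms(1)] elts_hier_Vset[OF elts_Vof])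
qed


section \<open>Categoricity of the next inaccessible cardinal\<close>

text \<open>The abstract property \<open>Q\<close> lets one argument serve every order. Uniqueness
  forces the witness in \<open>\<Theta>\<close> to be \<open>\<kappa>\<close>, and leastness of
  \<open>\<mu>\<close> does the rest.\<close>

lemma next_inaccessible_first_order_categorical:
  fixes \<kappa> \<mu> :: "'v::zfc_universe"
  assumes Q: "definable (\<lambda>\<nu> e. inaccessible (e 0) \<and> Q (e 0))"
    and \<kappa>: "inaccessible \<kappa>" "Q \<kappa>"
    and unique: "\<And>\<delta>. inaccessible \<delta> \<Longrightarrow> \<delta> \<noteq> \<kappa> \<Longrightarrow> \<not> Q \<delta>"
    and succ: "next_inaccessible \<kappa> \<mu>"
  shows "first_order_sententially_categorical \<mu>"
proof -
  define \<Theta> where "\<Theta> \<nu> \<longleftrightarrow> (\<exists>\<delta>\<in>Vset \<nu>. (inaccessible \<delta> \<and> Q \<delta>) \<and>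
      (\<forall>x\<in>Vset \<nu>. inaccessible x \<longrightarrow> \<not> \<delta> \<in> elts x))" for \<nu>
  have "definable (\<lambda>\<nu> e. \<Theta> \<nu>)"
    unfolding \<Theta>_def
    by (rule definable_ex, rule definable_conj[OF Q])
      (intro definable_all definable_imp definable_inaccessible definable_not definable_mem)
  then obtain \<phi> where \<phi>: "\<And>\<nu> e. inaccessible \<nu> \<Longrightarrow> range e \<subseteq> Vset \<nu> \<Longrightarrow> sat (Vset \<nu>) e \<phi> \<longleftrightarrow> \<Theta> \<nu>"
    unfolding definable_def by blast
  obtain \<sigma> where \<sigma>: "fv \<sigma> = {}" "\<And>M :: 'v set. models M \<sigma> = models M \<phi>"
    using universal_closure by metis
  have models: "models (Vset \<nu>) \<sigma> \<longleftrightarrow> \<Theta> \<nu>" if "inaccessible \<nu>" for \<nu>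
  proof -
    \<comment> \<open>Some valuation into the level must exist; otherwise \<open>models\<close>
      could hold vacuously.\<close>
    have "range (\<lambda>_ :: nat. set_of {}) \<subseteq> Vset \<nu>"
      using empty_in_Vset[OF that] by auto
    then show ?thesis
      unfolding \<sigma>(2) unfolding models_def by (auto simp: \<phi>[OF that])
  qed
  have \<mu>: "inaccessible \<mu>" "\<kappa> \<in> elts \<mu>"
    and least: "\<And>\<nu>. inaccessible \<nu> \<Longrightarrow> \<kappa> \<in> elts \<nu> \<Longrightarrow> \<mu> = \<nu> \<or> \<mu> \<in> elts \<nu>"
    using succ by (auto simp: next_inaccessible_def)
  have mem: "x \<in> Vset \<nu> \<longleftrightarrow> x \<in> elts \<nu>" if "inaccessible x" "inaccessible \<nu>" for x \<nu>
    using ordinal_in_Vset_iff that inaccessible_ordinal by blast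
  have "\<Theta> \<mu>"
    unfolding \<Theta>_def
  proof (intro bexI[of _ \<kappa>] conjI ballI impI)
    \<comment> \<open>If \<open>\<kappa>\<close> were in \<open>x\<close>, leastness would give
      \<open>\<mu> = x\<close> or \<open>\<mu> \<in> elts x\<close>, contradicting that
      \<open>x\<close> is below \<open>\<mu>\<close>.\<close>
    fix x assume "x \<in> Vset \<mu>" "inaccessible x"
    then show "\<kappa> \<notin> elts x"
      using least mem \<mu> mem_irrefl mem_asym by blast
  qed (use \<kappa> \<mu> mem in auto)
  moreover have "\<nu> = \<mu>" if \<nu>: "inaccessible \<nu>" and "\<Theta> \<nu>" for \<nu>
  proof -
    from \<open>\<Theta> \<nu>\<close> have "\<kappa> \<in> Vset \<nu>" "\<And>x. x \<in> Vset \<nu> \<Longrightarrow> inaccessible x \<Longrightarrow> \<kappa> \<notin> elts x"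
      unfolding \<Theta>_def using unique by blast+
    \<comment> \<open>Now \<open>\<kappa>\<close> is below \<open>\<nu>\<close>, so
      \<open>\<mu> = \<nu>\<close> or \<open>\<mu>\<close> is below \<open>\<nu>\<close>. In the
      latter case \<open>\<mu>\<close> is an inaccessible above \<open>\<kappa>\<close> inside the
      level, which \<open>\<Theta> \<nu>\<close> forbids.\<close>
    then show ?thesis
      using least[OF \<nu>] \<mu> mem \<kappa>(1) \<nu> by blast
  qed
  ultimately show ?thesis
    unfolding first_order_sententially_categorical_def using \<sigma>(1) \<mu>(1) models by blast
qed

theorem theorem7:
  fixes \<kappa> \<mu> :: "'v::zfc_universe"
  assumes "cardinal \<kappa>"
    and "first_order_sententially_categorical \<kappa> \<or>
         second_order_sententially_categorical \<kappa> \<or>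
         (\<exists>\<alpha>. absolutely_definable \<alpha> \<and> order_sententially_categorical \<alpha> \<kappa>)"
    and "next_inaccessible \<kappa> \<mu>"
  shows "first_order_sententially_categorical \<mu>"
  using assms(2)
proof (elim disjE exE conjE)
  assume "first_order_sententially_categorical \<kappa>"
  then obtain \<sigma> where "fv \<sigma> = {}" "inaccessible \<kappa>" "models (Vset \<kappa>) \<sigma>"
    "\<And>\<delta>. inaccessible \<delta> \<Longrightarrow> \<delta> \<noteq> \<kappa> \<Longrightarrow> \<not> models (Vset \<delta>) \<sigma>"
    unfolding first_order_sententially_categorical_def by blast
  \<comment> \<open>\<open>Q\<close> is instantiated with truth of \<open>\<sigma>\<close> in the
    level of its argument; the other two cases change only this predicate.\<close>
  then show ?thesis
    using next_inaccessible_first_order_categorical[OF definable_models] assms(3) by blast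
next
  assume "second_order_sententially_categorical \<kappa>"
  then obtain \<sigma> where "so_fv \<sigma> = {}" "so_set_fv \<sigma> = {}" "inaccessible \<kappa>" "so_models (Vset \<kappa>) \<sigma>"
    "\<And>\<delta>. inaccessible \<delta> \<Longrightarrow> \<delta> \<noteq> \<kappa> \<Longrightarrow> \<not> so_models (Vset \<delta>) \<sigma>"
    unfolding second_order_sententially_categorical_def by blast
  then show ?thesis
    using next_inaccessible_first_order_categorical[OF definable_so_models] assms(3) by blast
next
  fix \<alpha> assume \<alpha>: "absolutely_definable \<alpha>" and "order_sententially_categorical \<alpha> \<kappa>"
  then obtain \<sigma> where "ho_fv \<sigma> = {}" "inaccessible \<kappa>"
    "ho_models (Vset (oadd \<kappa> \<alpha>)) (Vset \<kappa>) \<sigma>"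
    "\<And>\<delta>. inaccessible \<delta> \<Longrightarrow> \<delta> \<noteq> \<kappa> \<Longrightarrow> \<not> ho_models (Vset (oadd \<delta> \<alpha>)) (Vset \<delta>) \<sigma>"
    unfolding order_sententially_categorical_def by blast
  then show ?thesis
    using next_inaccessible_first_order_categorical[OF definable_ho_models[OF _ \<alpha>]] assms(3)
    by blast
qed

end
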